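(* Let $n\geq 3$ be an integer and let $\varphi:H_n^+(\mathbb{R})\to H_n^+(\mathbb{R})$ be a map. Then $\varphi$ is surjective, additive, and preserves the minus order $\leq^-$ in both directions if and only if there exists an invertible matrix $S\in M_n(\mathbb{R})$ such that $\varphi(A)=SAS^t$ for every $A\in H_n^+(\mathbb{R})$.
   Context: $M_n(\mathbb{R})$ is the set of real $n\times n$ matrices and $A^t$ denotes the transpose of $A$. $H_n^+(\mathbb{R})$ is the set of all positive semidefinite real $n\times n$ matrices, i.e. symmetric $A\in M_n(\mathbb{R})$ with $x^tAx\geq 0$ for every $x\in\mathbb{R}^n$. An inner generalized inverse of $A\in M_n(\mathbb{R})$ is any matrix $A^-\in M_n(\mathbb{R})$ with $AA^-A=A$. The minus partial order is defined by: $A\leq^- B$ when $A^-A=A^-B$ and $AA^-=BA^-$ for some inner generalized inverse $A^-$ of $A$; equivalently, $\operatorname{rank}(B-A)=\operatorname{rank}(B)-\operatorname{rank}(A)$. The map $\varphi$ is additive if $\varphi(A+B)=\varphi(A)+\varphi(B)$ for all $A,B\in H_n^+(\mathbb{R})$. It preserves $\leq^-$ in both directions if, for all $A,B\in H_n^+(\mathbb{R})$, $A\leq^- B$ if and only if $\varphi(A)\leq^-\varphi(B)$. *)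

theory Defs
  imports "HOL-Analysis.Analysis"
begin

definition psd_matrices :: "(real ^ 'n ^ 'n) set" where
  "psd_matrices = {A. transpose A = A \<and> (\<forall>x. 0 \<le> x \<bullet> (A *v x))}"

definition inner_generalized_inverse :: "real ^ 'n ^ 'n \<Rightarrow> real ^ 'n ^ 'n \<Rightarrow> bool" where
  "inner_generalized_inverse A G \<longleftrightarrow> A ** G ** A = A"

(* The generalized inverse G ranges over all square matrices, even when A and B are
   positive semidefinite. *)
definition minus_le :: "real ^ 'n ^ 'n \<Rightarrow> real ^ 'n ^ 'n \<Rightarrow> bool"  (infix "\<le>\<^sup>-" 50) where
  "A \<le>\<^sup>- B \<longleftrightarrow>
     (\<exists>G. inner_generalized_inverse A G \<and> G ** A = G ** B \<and> A ** G = B ** G)"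

definition additive_on_psd :: "(real ^ 'n ^ 'n \<Rightarrow> real ^ 'n ^ 'n) \<Rightarrow> bool" where
  "additive_on_psd \<phi> \<longleftrightarrow>
     (\<forall>A \<in> psd_matrices. \<forall>B \<in> psd_matrices. \<phi> (A + B) = \<phi> A + \<phi> B)"

definition preserves_minus_le_both_directions ::
    "(real ^ 'n ^ 'n \<Rightarrow> real ^ 'n ^ 'n) \<Rightarrow> bool" where
  "preserves_minus_le_both_directions \<phi> \<longleftrightarrow>
     (\<forall>A \<in> psd_matrices. \<forall>B \<in> psd_matrices. A \<le>\<^sup>- B \<longleftrightarrow> \<phi> A \<le>\<^sup>- \<phi> B)"

end

theory Submission
  imports Defs
begin

text \<open>
  One implication holds because a congruence \<open>A \<mapsto> S A S\<^sup>t\<close> transports inner generalized inverses: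
  if \<open>G\<close> witnesses \<open>A \<le>\<^sup>- B\<close>, then \<open>S\<^sup>-\<^sup>t G S\<^sup>-\<^sup>1\<close> witnesses the relation between the images.

  For the other implication, an additive map of the positive semidefinite cone to itself is
  automatically homogeneous for nonnegative scalars, since its quadratic forms are nonnegative
  additive functions of the scalar. The minus order detects squares, so squares
  \<open>x x\<^sup>t\<close> go to squares (\<open>outer_square_image\<close>): every nonzero positive semidefinite matrix has a
  nonzero square below it, by Wedderburn's rank reduction, while the only matrices below a square
  are \<open>0\<close> and the square itself. By surjectivity the square below \<open>\<phi>(x x\<^sup>t)\<close> has a preimage; the
  preimage lies below \<open>x x\<^sup>t\<close>, so it is \<open>x x\<^sup>t\<close>.

  Write \<open>\<phi>(e\<^sub>i e\<^sub>i\<^sup>t) = y\<^sub>i y\<^sub>i\<^sup>t\<close> and let \<open>T\<close> have the columns \<open>y\<^sub>i\<close>. Every positive semidefinite matrix is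
  dominated by a multiple of the identity, so by surjectivity \<open>\<phi>(I) = T T\<^sup>t\<close> is positive definite
  and \<open>T\<close> is invertible (\<open>images_of_basis_invertible\<close>). After composing with the congruence by
  \<open>T\<^sup>-\<^sup>1\<close>, every \<open>e\<^sub>i e\<^sub>i\<^sup>t\<close> is fixed. That the images of \<open>(e\<^sub>i + e\<^sub>j)(e\<^sub>i + e\<^sub>j)\<^sup>t\<close>,
  \<open>(e\<^sub>i - e\<^sub>j)(e\<^sub>i - e\<^sub>j)\<^sup>t\<close> and \<open>(2 e\<^sub>i + e\<^sub>j)(2 e\<^sub>i + e\<^sub>j)\<^sup>t\<close> are squares leaves a single free scalar
  per pair \<open>i, j\<close> (\<open>image_of_pair\<close>). So the normalised map multiplies each matrix entry by a
  constant \<open>s\<^sub>k\<^sub>l\<close> (\<open>acts_entrywise\<close>). The all-ones matrix is a square too and is mapped to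
  \<open>(s\<^sub>k\<^sub>l)\<close>, hence \<open>s\<^sub>k\<^sub>l = p\<^sub>k p\<^sub>l\<close>, and the normalised map is the congruence by the diagonal matrix
  of \<open>p\<close> (\<open>diagonal_congruence\<close>).
\<close>

section \<open>Squares of vectors and congruences\<close>

definition outer_square :: "real ^ 'n \<Rightarrow> real ^ 'n ^ 'n" where
  "outer_square x = (\<chi> i j. x $ i * x $ j)"

lemma outer_square_nth [simp]: "outer_square x $ i $ j = x $ i * x $ j"
  by (simp add: outer_square_def)

lemma outer_square_mult_vec: "outer_square x *v y = (x \<bullet> y) *\<^sub>R x"
  by (simp add: vec_eq_iff matrix_vector_mult_def inner_vec_def sum_distrib_left
      sum_distrib_right mult_ac)

lemma quadratic_form_congruence:
  fixes S A :: "real ^ 'n ^ 'n"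
  shows "x \<bullet> ((S ** A ** transpose S) *v x) = (transpose S *v x) \<bullet> (A *v (transpose S *v x))"
  by (metis dot_lmul_matrix matrix_vector_mul_assoc transpose_matrix_vector)

lemma outer_square_congruence:
  fixes S :: "real ^ 'n ^ 'n"
  shows "S ** outer_square x ** transpose S = outer_square (S *v x)"
proof (rule matrix_eq[THEN iffD2], rule allI)
  fix y
  have "(S ** outer_square x ** transpose S) *v y = (x \<bullet> (transpose S *v y)) *\<^sub>R (S *v x)"
    by (simp add: matrix_vector_mul_assoc[symmetric] outer_square_mult_vec matrix_vector_mult_scaleR)
  also have "x \<bullet> (transpose S *v y) = (S *v x) \<bullet> y"
    by (metis dot_lmul_matrix inner_commute transpose_matrix_vector)
  finally show "(S ** outer_square x ** transpose S) *v y = outer_square (S *v x) *v y"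
    by (simp add: outer_square_mult_vec)
qed

lemma congruence_add:
  fixes S A B :: "real ^ 'n ^ 'n"
  shows "S ** (A + B) ** transpose S = S ** A ** transpose S + S ** B ** transpose S"
  by (simp add: matrix_eq matrix_vector_mul_assoc[symmetric] matrix_vector_mult_add_rdistrib
      matrix_vector_right_distrib)

lemma congruence_sum:
  fixes S :: "real ^ 'n ^ 'n"
  shows "S ** sum f I ** transpose S = (\<Sum>i\<in>I. S ** f i ** transpose S)"
  by (induction I rule: infinite_finite_induct) (simp_all add: congruence_add)

lemma congruence_cancel:
  fixes S T A :: "real ^ 'n ^ 'n"
  assumes "S ** T = mat 1"
  shows "S ** (T ** A ** transpose T) ** transpose S = A"
proof -
  have "S ** (T ** A ** transpose T) ** transpose S = (S ** T) ** A ** transpose (S ** T)"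
    by (simp add: matrix_mul_assoc matrix_transpose_mul)
  then show ?thesis using assms by (simp add: transpose_mat)
qed

section \<open>The cone of positive semidefinite matrices\<close>

lemma psdD:
  assumes "A \<in> psd_matrices"
  shows "transpose A = A" "0 \<le> x \<bullet> (A *v x)"
  using assms by (auto simp: psd_matrices_def)

lemma psd_zero: "0 \<in> psd_matrices"
  by (simp add: psd_matrices_def transpose_def vec_eq_iff)

lemma psd_add: "A \<in> psd_matrices \<Longrightarrow> B \<in> psd_matrices \<Longrightarrow> A + B \<in> psd_matrices"
  by (auto simp: psd_matrices_def transpose_def vec_eq_iff matrix_vector_mult_add_rdistrib
      inner_add_right)

lemma psd_scaleR: "A \<in> psd_matrices \<Longrightarrow> 0 \<le> t \<Longrightarrow> t *\<^sub>R A \<in> psd_matrices"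
  by (auto simp: psd_matrices_def transpose_def vec_eq_iff scaleR_matrix_vector_assoc[symmetric])

lemma psd_outer_square: "outer_square x \<in> psd_matrices"
  by (auto simp: psd_matrices_def transpose_def vec_eq_iff outer_square_mult_vec inner_commute)

lemma psd_sum: "(\<And>i. i \<in> I \<Longrightarrow> f i \<in> psd_matrices) \<Longrightarrow> sum f I \<in> psd_matrices"
  by (induction I rule: infinite_finite_induct) (auto simp: psd_zero psd_add)

lemma psd_congruence:
  fixes S A :: "real ^ 'n ^ 'n"
  assumes "A \<in> psd_matrices"
  shows "S ** A ** transpose S \<in> psd_matrices"
  using assms unfolding psd_matrices_def
  by (auto simp: quadratic_form_congruence) (simp add: matrix_transpose_mul matrix_mul_assoc)

text \<open>Polarisation: testing the quadratic form on \<open>e\<^sub>i + e\<^sub>j\<close> recovers the entry at \<open>i, j\<close>.\<close>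

lemma symmetric_eq_zeroI:
  fixes A :: "real ^ 'n ^ 'n"
  assumes "transpose A = A" and zero: "\<And>x. x \<bullet> (A *v x) = 0"
  shows "A = 0"
proof -
  have entry: "axis i 1 \<bullet> (A *v axis j 1) = A $ i $ j" for i j
    by (simp add: inner_axis' matrix_vector_mult_basis column_def)
  have "A $ i $ j = 0" for i j
  proof -
    have "A $ i $ j = A $ j $ i"
      using assms(1) by (metis transpose_def vec_lambda_beta)
    moreover have "0 = A $ i $ i + A $ i $ j + (A $ j $ i + A $ j $ j)"
      using zero[of "axis i 1 + axis j 1"]
      by (simp add: matrix_vector_right_distrib inner_add_left inner_add_right entry)
    moreover have "A $ i $ i = 0" "A $ j $ j = 0"
      using zero[of "axis i 1"] zero[of "axis j 1"] by (simp_all add: entry)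
    ultimately show ?thesis by simp
  qed
  then show ?thesis by (simp add: vec_eq_iff)
qed

section \<open>Additive maps of the cone\<close>

text \<open>
  Nonnegativity makes \<open>g\<close> monotone, so \<open>n g(t) = g(n t)\<close> and \<open>n t g(1)\<close> both lie between the values
  of \<open>g\<close> at two consecutive natural numbers. Their difference is bounded by \<open>g(1)\<close> for every \<open>n\<close>,
  which forces it to vanish.
\<close>

lemma additive_nonneg_real_linear:
  fixes g :: "real \<Rightarrow> real"
  assumes nonneg: "\<And>t. 0 \<le> t \<Longrightarrow> 0 \<le> g t"
    and add: "\<And>s t. 0 \<le> s \<Longrightarrow> 0 \<le> t \<Longrightarrow> g (s + t) = g s + g t"
    and "0 \<le> t"
  shows "g t = t * g 1"
proof -
  have g0: "g 0 = 0" using add[of 0 0] by simp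
  have mono: "g s \<le> g r" if "0 \<le> s" "s \<le> r" for s r
    using add[of s "r - s"] nonneg[of "r - s"] that by simp
  have mult: "g (real n * s) = real n * g s" if "0 \<le> s" for n s
    using that by (induction n) (simp_all add: g0 add distrib_right)
  have bound: "real n * \<bar>g t - t * g 1\<bar> \<le> g 1" for n
  proof -
    define m where "m = nat \<lfloor>real n * t\<rfloor>"
    have m: "real m \<le> real n * t" "real n * t \<le> real (Suc m)"
      using \<open>0 \<le> t\<close> unfolding m_def by (simp_all add: of_nat_nat) linarith
    have "real m * g 1 \<le> real n * g t" "real n * g t \<le> real (Suc m) * g 1"
      using mono[OF _ m(1)] mono[OF _ m(2)] mult[of 1 m] mult[of 1 "Suc m"] mult[of t n] \<open>0 \<le> t\<close>
      by (simp_all del: of_nat_Suc)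
    moreover have "real m * g 1 \<le> real n * t * g 1" "real n * t * g 1 \<le> real (Suc m) * g 1"
      using m nonneg[of 1] by (simp_all add: mult_right_mono del: of_nat_Suc)
    ultimately have "\<bar>real n * g t - real n * t * g 1\<bar> \<le> g 1"
      by (simp add: distrib_right abs_le_iff)
    moreover have "real n * \<bar>g t - t * g 1\<bar> = \<bar>real n * (g t - t * g 1)\<bar>"
      by (simp only: abs_mult abs_of_nat)
    ultimately show ?thesis by (simp only: right_diff_distrib mult.assoc)
  qed
  show ?thesis
  proof (rule ccontr)
    assume "g t \<noteq> t * g 1"
    then obtain n where "g 1 < real n * \<bar>g t - t * g 1\<bar>"
      using ex_less_of_nat_mult[of "\<bar>g t - t * g 1\<bar>" "g 1"] by auto
    with bound[of n] show False by simp
  qed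
qed

locale additive_psd_map =
  fixes \<phi> :: "real ^ 'n ^ 'n \<Rightarrow> real ^ 'n ^ 'n"
  assumes maps: "\<And>A. A \<in> psd_matrices \<Longrightarrow> \<phi> A \<in> psd_matrices"
    and add: "\<And>A B. A \<in> psd_matrices \<Longrightarrow> B \<in> psd_matrices \<Longrightarrow> \<phi> (A + B) = \<phi> A + \<phi> B"
begin

lemma zero: "\<phi> 0 = 0"
  using add[OF psd_zero psd_zero] by simp

lemma sum:
  "(\<And>i. i \<in> I \<Longrightarrow> f i \<in> psd_matrices) \<Longrightarrow> \<phi> (sum f I) = (\<Sum>i\<in>I. \<phi> (f i))"
  by (induction I rule: infinite_finite_induct) (auto simp: zero add psd_sum)

lemma scaleR:
  assumes A: "A \<in> psd_matrices" and "0 \<le> t"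
  shows "\<phi> (t *\<^sub>R A) = t *\<^sub>R \<phi> A"
proof -
  have "x \<bullet> (\<phi> (t *\<^sub>R A) *v x) = t * (x \<bullet> (\<phi> (1 *\<^sub>R A) *v x))" for x
    by (rule additive_nonneg_real_linear[of "\<lambda>t. x \<bullet> (\<phi> (t *\<^sub>R A) *v x)"])
      (use A \<open>0 \<le> t\<close> in \<open>auto simp: psdD(2) maps psd_scaleR scaleR_add_left add
        matrix_vector_mult_add_rdistrib inner_add_right\<close>)
  then have "x \<bullet> ((\<phi> (t *\<^sub>R A) - t *\<^sub>R \<phi> A) *v x) = 0" for x
    by (simp add: matrix_vector_mult_diff_rdistrib inner_diff_right
        scaleR_matrix_vector_assoc[symmetric])
  moreover have "transpose (\<phi> (t *\<^sub>R A) - t *\<^sub>R \<phi> A) = \<phi> (t *\<^sub>R A) - t *\<^sub>R \<phi> A"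
    using psdD(1)[OF maps[OF A]] psdD(1)[OF maps[OF psd_scaleR[OF assms]]]
    by (simp add: transpose_def vec_eq_iff)
  ultimately show ?thesis
    using symmetric_eq_zeroI by (metis eq_iff_diff_eq_0)
qed

end

text \<open>The operator norm serves as the bound: the identity is an order unit of the cone.\<close>

lemma psd_bounded_by_mat:
  fixes A :: "real ^ 'n ^ 'n"
  assumes "A \<in> psd_matrices"
  obtains c where "0 \<le> c" "c *\<^sub>R mat 1 - A \<in> psd_matrices"
proof
  let ?c = "onorm ((*v) A)"
  show "0 \<le> ?c" by (simp add: onorm_pos_le)
  have "x \<bullet> (A *v x) \<le> ?c * (x \<bullet> x)" for x
  proof -
    have "x \<bullet> (A *v x) \<le> norm x * norm (A *v x)" by (rule norm_cauchy_schwarz)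
    also have "\<dots> \<le> norm x * (?c * norm x)"
      by (intro mult_left_mono onorm) auto
    finally show ?thesis by (simp add: dot_square_norm power2_eq_square mult_ac)
  qed
  then show "?c *\<^sub>R mat 1 - A \<in> psd_matrices"
    using psdD(1)[OF assms] unfolding psd_matrices_def
    by (auto simp: matrix_vector_mult_diff_rdistrib inner_diff_right
        scaleR_matrix_vector_assoc[symmetric]) (auto simp: transpose_def vec_eq_iff mat_def)
qed

lemma sum_axis_delta:
  fixes f :: "'n::finite \<Rightarrow> 'n \<Rightarrow> real"
  shows "(\<Sum>i\<in>UNIV. \<Sum>j\<in>UNIV. f i j * (axis i 1 $ p * axis j 1 $ q)) = f p q"
proof -
  have "f i j * (axis i 1 $ p * axis j 1 $ q) = (if j = q then if i = p then f p q else 0 else 0)"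
    for i j
    by (simp add: axis_def)
  then show ?thesis by simp
qed

lemma mat_1_eq_sum_outer_square: "(mat 1 :: real ^ 'n ^ 'n) = (\<Sum>i\<in>UNIV. outer_square (axis i 1))"
proof -
  have "axis i (1::real) $ k * axis i 1 $ l = (if i = k then if k = l then 1 else 0 else 0)" for i k l :: 'n
    by (simp add: axis_def)
  then show ?thesis by (simp add: vec_eq_iff mat_def)
qed

text \<open>
  If \<open>z\<close> were a nonzero vector in the kernel of \<open>T\<^sup>t\<close>, the form of \<open>\<phi>(I) = T T\<^sup>t\<close> would vanish at \<open>z\<close>.
  But \<open>z z\<^sup>t\<close> is the image of some \<open>A\<close> with \<open>A\<close> dominated by \<open>c I\<close>, so its form, which is positive
  at \<open>z\<close>, is dominated by that of \<open>c \<phi>(I)\<close>.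
\<close>

lemma (in additive_psd_map) images_of_basis_invertible:
  assumes surj: "\<phi> ` psd_matrices = psd_matrices"
    and T: "\<And>i. \<phi> (outer_square (axis i 1)) = outer_square (T *v axis i 1)"
  shows "invertible T"
proof -
  have "\<phi> (mat 1) = T ** mat 1 ** transpose T"
    by (simp add: mat_1_eq_sum_outer_square sum psd_outer_square T outer_square_congruence congruence_sum)
  have "z = 0" if z: "transpose T *v z = 0" for z
  proof -
    obtain A where A: "A \<in> psd_matrices" "\<phi> A = outer_square z"
      using surj psd_outer_square by (metis imageE)
    obtain c where c: "0 \<le> c" "c *\<^sub>R mat 1 - A \<in> psd_matrices"
      using psd_bounded_by_mat[OF A(1)] .
    have one: "mat 1 \<in> psd_matrices"
      by (simp add: mat_1_eq_sum_outer_square psd_sum psd_outer_square)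
    have "c *\<^sub>R \<phi> (mat 1) = \<phi> (c *\<^sub>R mat 1 - A) + outer_square z"
      using add[OF c(2) A(1)] scaleR[OF one c(1)] A(2) by simp
    then have "z \<bullet> (outer_square z *v z) \<le> z \<bullet> ((c *\<^sub>R \<phi> (mat 1)) *v z)"
      using psdD(2)[OF maps[OF c(2)]] by (simp add: matrix_vector_mult_add_rdistrib inner_add_right)
    also have "\<dots> = 0"
      using z \<open>\<phi> (mat 1) = _\<close>
      by (simp add: scaleR_matrix_vector_assoc[symmetric] matrix_vector_mul_assoc[symmetric])
    finally have "z \<bullet> z \<le> 0" by (simp add: outer_square_mult_vec mult_le_0_iff)
    then show "z = 0" by (metis inner_gt_zero_iff not_le)
  qed
  then have "\<exists>B. B ** transpose T = mat 1"
    using matrix_left_invertible_ker by blast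
  then show ?thesis
    by (simp add: left_invertible_transpose invertible_right_inverse)
qed

section \<open>The minus order below squares\<close>

text \<open>
  Wedderburn's rank reduction: subtracting \<open>M v v\<^sup>t M / c\<close> with \<open>c = v\<^sup>t M v\<close> lowers the rank of \<open>M\<close>
  by one. The witness of the minus order is \<open>G = v v\<^sup>t / c\<close>.
\<close>

lemma outer_square_minus_le:
  fixes M :: "real ^ 'n ^ 'n"
  assumes sym: "transpose M = M" and pos: "0 < v \<bullet> (M *v v)"
  shows "outer_square ((1 / sqrt (v \<bullet> (M *v v))) *\<^sub>R (M *v v)) \<le>\<^sup>- M"
proof -
  define c where "c = v \<bullet> (M *v v)"
  define N where "N = outer_square ((1 / sqrt c) *\<^sub>R (M *v v))"
  define G where "G = outer_square ((1 / sqrt c) *\<^sub>R v)"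
  have c: "c > 0" using pos by (simp add: c_def)
  have move: "(M *v x) \<bullet> y = x \<bullet> (M *v y)" for x y
    by (metis dot_lmul_matrix sym transpose_matrix_vector)
  have N: "N *v x = (1 / c * (v \<bullet> (M *v x))) *\<^sub>R (M *v v)" for x
    using c by (simp add: N_def outer_square_mult_vec move)
  have G: "G *v x = (1 / c * (v \<bullet> x)) *\<^sub>R v" for x
    using c by (simp add: G_def outer_square_mult_vec)
  have "N ** G ** N = N"
    using c by (subst matrix_eq) (auto simp: matrix_vector_mul_assoc[symmetric] N G
        matrix_vector_mult_scaleR c_def[symmetric])
  moreover have "G ** N = G ** M"
    using c by (subst matrix_eq) (auto simp: matrix_vector_mul_assoc[symmetric] N G
        matrix_vector_mult_scaleR c_def[symmetric])
  moreover have "N ** G = M ** G"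
    using c by (subst matrix_eq) (auto simp: matrix_vector_mul_assoc[symmetric] N G
        matrix_vector_mult_scaleR c_def[symmetric])
  ultimately show ?thesis
    unfolding minus_le_def inner_generalized_inverse_def N_def c_def by blast
qed

text \<open>
  With \<open>A = x x\<^sup>t\<close> and a witness \<open>G\<close>, the matrix \<open>C\<close> equals \<open>A G A\<close> and is therefore a multiple \<open>s A\<close>; since also
  \<open>C = A G C\<close>, it follows that \<open>C = s C\<close>.
\<close>

lemma minus_le_outer_squareD:
  fixes C :: "real ^ 'n ^ 'n"
  assumes "C \<le>\<^sup>- outer_square x"
  shows "C = 0 \<or> C = outer_square x"
proof -
  define A where "A = outer_square x"
  obtain G where G: "C ** G ** C = C" "G ** C = G ** A" "C ** G = A ** G"
    using assms unfolding minus_le_def inner_generalized_inverse_def A_def by blast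
  have "C = A ** G ** A"
    using G by (metis matrix_mul_assoc)
  define s where "s = x \<bullet> (G *v x)"
  have CA: "C = s *\<^sub>R A"
    by (subst matrix_eq) (auto simp: \<open>C = A ** G ** A\<close> A_def matrix_vector_mul_assoc[symmetric]
        outer_square_mult_vec matrix_vector_mult_scaleR s_def
        scaleR_matrix_vector_assoc[symmetric] mult.commute)
  have "C = A ** G ** C"
    using G by (metis matrix_mul_assoc)
  also have "\<dots> = s *\<^sub>R (A ** G ** A)"
    by (simp add: CA matrix_scalar_ac scalar_matrix_assoc)
  finally have "C = s *\<^sub>R C"
    using \<open>C = A ** G ** A\<close> by simp
  then show ?thesis using CA A_def by (cases "s = 1") auto
qed

text \<open>
  Being a square can be read off the minus order, because squares are exactly the minimal nonzero
  elements of the cone together with \<open>0\<close>.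
\<close>

lemma (in additive_psd_map) outer_square_image:
  assumes surj: "\<phi> ` psd_matrices = psd_matrices"
    and pres: "preserves_minus_le_both_directions \<phi>"
  shows "\<exists>y. \<phi> (outer_square x) = outer_square y"
proof (cases "\<phi> (outer_square x) = 0")
  case True
  then have "\<phi> (outer_square x) = outer_square 0" by (simp add: vec_eq_iff)
  then show ?thesis ..
next
  case False
  let ?M = "\<phi> (outer_square x)"
  have M: "?M \<in> psd_matrices" by (simp add: maps psd_outer_square)
  obtain v where "v \<bullet> (?M *v v) \<noteq> 0"
    using False symmetric_eq_zeroI psdD(1)[OF M] by blast
  then have v: "0 < v \<bullet> (?M *v v)"
    using psdD(2)[OF M, of v] by simp
  define y where "y = (1 / sqrt (v \<bullet> (?M *v v))) *\<^sub>R (?M *v v)"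
  have le: "outer_square y \<le>\<^sup>- ?M"
    unfolding y_def by (rule outer_square_minus_le[OF psdD(1)[OF M] v])
  obtain C where C: "C \<in> psd_matrices" "\<phi> C = outer_square y"
    using surj psd_outer_square by (metis imageE)
  have "C \<le>\<^sup>- outer_square x"
    using pres le C psd_outer_square unfolding preserves_minus_le_both_directions_def by metis
  moreover have "C \<noteq> 0"
  proof
    assume "C = 0"
    then have "outer_square y = 0" using C zero by simp
    then have "y = 0" by (metis inner_eq_zero_iff outer_square_mult_vec
        matrix_vector_mult_0 scaleR_eq_0_iff)
    then show False using v y_def by auto
  qed
  ultimately have "C = outer_square x" using minus_le_outer_squareD by blast
  then show ?thesis using C by blast
qed

section \<open>Maps fixing the squares of the basis vectors\<close>

text \<open>
  An additive map on the cone can be computed at \<open>A\<close> from its values at squares of vectors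
  supported on at most two coordinates: the off-diagonal part of
  \<open>(e\<^sub>i \<plusminus> e\<^sub>j)(e\<^sub>i \<plusminus> e\<^sub>j)\<^sup>t\<close> carries the entry of \<open>A\<close>, and adding the diagonal matrices on the left
  keeps both sides inside the cone, where no subtraction is available. Summing over all ordered
  pairs counts every entry twice, whence the factor 2.
\<close>

lemma symmetric_decomposition:
  fixes A :: "real ^ 'n ^ 'n"
  assumes "transpose A = A"
  shows "2 *\<^sub>R A + (\<Sum>i\<in>UNIV. \<Sum>j\<in>UNIV. \<bar>A $ i $ j\<bar> *\<^sub>R
            (outer_square (axis i 1) + outer_square (axis j 1)))
       = (\<Sum>i\<in>UNIV. \<Sum>j\<in>UNIV. \<bar>A $ i $ j\<bar> *\<^sub>R
            outer_square (axis i 1 + sgn (A $ i $ j) *\<^sub>R axis j 1))" (is "?L = ?R")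
proof -
  have "?L $ k $ l = ?R $ k $ l" for k l
  proof -
    have "A $ k $ l = A $ l $ k"
      using assms by (metis transpose_def vec_lambda_beta)
    define d :: "'n \<Rightarrow> 'n \<Rightarrow> real" where "d i j = (if j = i then 1 else 0)" for i j
    have ax: "axis i 1 $ j = d i j" for i j by (simp add: d_def axis_def)
    have "\<bar>a\<bar> * ((d i k + sgn a * d j k) * (d i l + sgn a * d j l))
       = \<bar>a\<bar> * (d i k * d i l + d j k * d j l) + (a * (d i k * d j l) + a * (d i l * d j k))" for i j a
      by (simp add: sgn_if abs_if algebra_simps d_def)
    then have R: "?R $ k $ l = (\<Sum>i\<in>UNIV. \<Sum>j\<in>UNIV. \<bar>A $ i $ j\<bar> * (d i k * d i l + d j k * d j l))
       + ((\<Sum>i\<in>UNIV. \<Sum>j\<in>UNIV. A $ i $ j * (d i k * d j l)) +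
          (\<Sum>i\<in>UNIV. \<Sum>j\<in>UNIV. A $ i $ j * (d i l * d j k)))"
      by (simp add: ax sum.distrib)
    have "(\<Sum>i\<in>UNIV. \<Sum>j\<in>UNIV. A $ i $ j * (d i k * d j l)) = A $ k $ l"
      using sum_axis_delta[of "\<lambda>i j. A $ i $ j" k l] by (simp add: ax)
    moreover have "(\<Sum>i\<in>UNIV. \<Sum>j\<in>UNIV. A $ i $ j * (d i l * d j k)) = A $ l $ k"
      using sum_axis_delta[of "\<lambda>i j. A $ i $ j" l k] by (simp add: ax)
    ultimately show ?thesis
      using R \<open>A $ k $ l = A $ l $ k\<close> by (simp add: ax)
  qed
  then show ?thesis by (simp only: vec_eq_iff) blast
qed

text \<open>
  Let \<open>u u\<^sup>t\<close>, \<open>w w\<^sup>t\<close>, \<open>v v\<^sup>t\<close> be the images of the squares of \<open>e + f\<close>, \<open>e - f\<close>, \<open>2 e + f\<close>. The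
  parallelogram law expresses \<open>w w\<^sup>t\<close> through \<open>u u\<^sup>t\<close> and shows that \<open>u\<close> is supported on the two
  coordinates \<open>i, j\<close>; a similar identity expresses \<open>v v\<^sup>t\<close>. The vanishing determinants of the
  \<open>2 \<times> 2\<close> blocks of \<open>w w\<^sup>t\<close> and \<open>v v\<^sup>t\<close> then give \<open>u\<^sub>i\<^sup>2 = u\<^sub>j\<^sup>2 = 1\<close>, and the scalar is \<open>s = u\<^sub>i u\<^sub>j\<close>.
\<close>

lemma (in additive_psd_map) image_of_pair:
  assumes outer: "\<And>x. \<exists>y. \<phi> (outer_square x) = outer_square y"
    and basis: "\<And>i. \<phi> (outer_square (axis i 1)) = outer_square (axis i 1)"
  shows "\<exists>s. \<forall>\<sigma> \<in> {-1, 1}. \<forall>k l.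
    \<phi> (outer_square (axis i 1 + \<sigma> *\<^sub>R axis j 1)) $ k $ l
      = axis i 1 $ k * axis i 1 $ l + axis j 1 $ k * axis j 1 $ l
        + \<sigma> * s * (axis i 1 $ k * axis j 1 $ l + axis j 1 $ k * axis i 1 $ l)"
proof (cases "i = j")
  case True
  have "\<phi> (outer_square (axis i 1 + axis i 1)) = 4 *\<^sub>R outer_square (axis i 1)"
  proof -
    have "outer_square (axis i 1 + axis i 1) = 4 *\<^sub>R outer_square (axis i (1::real))"
      by (simp add: vec_eq_iff algebra_simps)
    then show ?thesis by (simp add: scaleR psd_outer_square basis)
  qed
  moreover have "\<phi> (outer_square 0) = 0"
    by (metis zero outer_square_nth zero_index mult_zero_left vec_eq_iff)
  ultimately show ?thesis
    unfolding True[symmetric] by (intro exI[of _ 1]) simp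
next
  case False
  define e :: "real ^ 'n" where "e = axis i 1"
  define f :: "real ^ 'n" where "f = axis j 1"
  obtain u where u: "\<phi> (outer_square (e + f)) = outer_square u" using outer by blast
  obtain w where w: "\<phi> (outer_square (e - f)) = outer_square w" using outer by blast
  obtain v where v: "\<phi> (outer_square (2 *\<^sub>R e + f)) = outer_square v" using outer by blast
  note bs = basis[of i, folded e_def] basis[of j, folded f_def]
  have "\<phi> (outer_square (e + f) + outer_square (e - f))
      = \<phi> (2 *\<^sub>R outer_square e + 2 *\<^sub>R outer_square f)"
    by (rule arg_cong[of _ _ \<phi>]) (simp add: vec_eq_iff algebra_simps)
  then have "outer_square u + outer_square w = 2 *\<^sub>R outer_square e + 2 *\<^sub>R outer_square f"
    by (simp add: add scaleR psd_outer_square psd_scaleR bs u w)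
  then have uw: "u $ k * u $ l + w $ k * w $ l = 2 * (e $ k * e $ l) + 2 * (f $ k * f $ l)" for k l
    by (simp add: vec_eq_iff)
  have "\<phi> (outer_square (2 *\<^sub>R e + f) + outer_square f)
      = \<phi> (2 *\<^sub>R outer_square e + 2 *\<^sub>R outer_square (e + f))"
    by (rule arg_cong[of _ _ \<phi>]) (simp add: vec_eq_iff algebra_simps)
  then have "outer_square v + outer_square f = 2 *\<^sub>R outer_square e + 2 *\<^sub>R outer_square u"
    by (simp add: add scaleR psd_outer_square psd_scaleR bs u v)
  then have vu: "v $ k * v $ l + f $ k * f $ l = 2 * (e $ k * e $ l) + 2 * (u $ k * u $ l)" for k l
    by (simp add: vec_eq_iff)
  have ef: "e $ i = 1" "e $ j = 0" "f $ i = 0" "f $ j = 1" using False by (simp_all add: e_def f_def axis_def)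
  have off: "e $ k = 0" "f $ k = 0" if "k \<noteq> i" "k \<noteq> j" for k
    using that by (simp_all add: e_def f_def axis_def)
  have u_off: "u $ k = 0" if "k \<noteq> i" "k \<noteq> j" for k
    using uw[of k k] off[OF that] by (simp add: sum_squares_eq_zero_iff)
  define a b where "a = u $ i * u $ i" and "b = u $ j * u $ j"
  \<comment> \<open>The \<open>2 \<times> 2\<close> minors of a matrix \<open>x x\<^sup>t\<close> vanish.\<close>
  have prod: "(x * x) * (y * y) = (x * y) * (x * y)" for x y :: real by simp
  have "(2 + 2 * a) * (2 * b - 1) = 4 * (a * b)"
  proof -
    have "v $ i * v $ i = 2 + 2 * a" "v $ j * v $ j = 2 * b - 1" "v $ i * v $ j = 2 * (u $ i * u $ j)"
      using vu[of i i] vu[of j j] vu[of i j] by (simp_all add: ef a_def b_def)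
    then have "(2 + 2 * a) * (2 * b - 1) = (2 * (u $ i * u $ j)) * (2 * (u $ i * u $ j))"
      by (metis prod)
    then show ?thesis by (simp add: a_def b_def mult_ac)
  qed
  moreover have "(2 - a) * (2 - b) = a * b"
  proof -
    have "w $ i * w $ i = 2 - a" "w $ j * w $ j = 2 - b" "w $ i * w $ j = - (u $ i * u $ j)"
      using uw[of i i] uw[of j j] uw[of i j] by (simp_all add: ef a_def b_def)
    then have "(2 - a) * (2 - b) = (- (u $ i * u $ j)) * (- (u $ i * u $ j))"
      by (metis prod)
    then show ?thesis by (simp add: a_def b_def mult_ac)
  qed
  ultimately have ab: "a = 1" "b = 1"
    by (simp_all add: algebra_simps)
  have u_entry: "u $ k * u $ l = e $ k * e $ l + f $ k * f $ l
      + (u $ i * u $ j) * (e $ k * f $ l + f $ k * e $ l)" for k l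
    using ab by (cases "k = i"; cases "k = j"; cases "l = i"; cases "l = j")
      (auto simp: ef off u_off a_def b_def False)
  have w_entry: "w $ k * w $ l = e $ k * e $ l + f $ k * f $ l
      - (u $ i * u $ j) * (e $ k * f $ l + f $ k * e $ l)" for k l
    using uw[of k l] u_entry[of k l] by linarith
  have "\<phi> (outer_square (e + \<sigma> *\<^sub>R f)) $ k $ l = e $ k * e $ l + f $ k * f $ l
      + \<sigma> * (u $ i * u $ j) * (e $ k * f $ l + f $ k * e $ l)" if "\<sigma> \<in> {-1, 1}" for \<sigma> k l
  proof (cases "\<sigma> = 1")
    case True
    then show ?thesis using u_entry[of k l] by (simp add: u)
  next
    case False
    then have "\<sigma> = - 1" using that by simp
    then show ?thesis using w_entry[of k l] by (simp add: w)
  qed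
  then show ?thesis unfolding e_def f_def by blast
qed

text \<open>
  Applying the map to \<open>symmetric_decomposition\<close> leaves the diagonal corrections unchanged, so they
  cancel, and each off-diagonal contribution is multiplied by the scalar of its pair. That scalar
  is chosen separately for \<open>(k, l)\<close> and \<open>(l, k)\<close>, so the multiplier is the mean of both.
\<close>

lemma (in additive_psd_map) acts_entrywise:
  assumes outer: "\<And>x. \<exists>y. \<phi> (outer_square x) = outer_square y"
    and basis: "\<And>i. \<phi> (outer_square (axis i 1)) = outer_square (axis i 1)"
  shows "\<exists>s. \<forall>A \<in> psd_matrices. \<forall>k l. \<phi> A $ k $ l = s k l * A $ k $ l"
proof -
  define d :: "'n \<Rightarrow> 'n \<Rightarrow> real" where "d i k = axis i 1 $ k" for i k
  obtain s where s: "\<And>i j \<sigma> k l. \<sigma> \<in> {-1, 1} \<Longrightarrow>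
     \<phi> (outer_square (axis i 1 + \<sigma> *\<^sub>R axis j 1)) $ k $ l
      = d i k * d i l + d j k * d j l + \<sigma> * s i j * (d i k * d j l + d j k * d i l)"
    using image_of_pair[OF assms] unfolding d_def by metis
  have delta: "(\<Sum>i\<in>UNIV. \<Sum>j\<in>UNIV. f i j * (d i p * d j q)) = f p q" for f p q
    unfolding d_def by (rule sum_axis_delta)
  have "\<phi> A $ k $ l = (s k l + s l k) / 2 * A $ k $ l" if A: "A \<in> psd_matrices" for A k l
  proof -
    have sym: "A $ l $ k = A $ k $ l"
      using psdD(1)[OF A] by (metis transpose_def vec_lambda_beta)
    note [simp] = psd_outer_square psd_add psd_scaleR psd_sum sum add scaleR basis
    have "2 *\<^sub>R \<phi> A + (\<Sum>i\<in>UNIV. \<Sum>j\<in>UNIV. \<bar>A $ i $ j\<bar> *\<^sub>R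
            (outer_square (axis i 1) + outer_square (axis j 1)))
       = (\<Sum>i\<in>UNIV. \<Sum>j\<in>UNIV. \<bar>A $ i $ j\<bar> *\<^sub>R
            \<phi> (outer_square (axis i 1 + sgn (A $ i $ j) *\<^sub>R axis j 1)))"
      using arg_cong[OF symmetric_decomposition[OF psdD(1)[OF A]], of \<phi>] A by simp
    then have "(2 *\<^sub>R \<phi> A + (\<Sum>i\<in>UNIV. \<Sum>j\<in>UNIV. \<bar>A $ i $ j\<bar> *\<^sub>R
            (outer_square (axis i 1) + outer_square (axis j 1)))) $ k $ l
       = (\<Sum>i\<in>UNIV. \<Sum>j\<in>UNIV. \<bar>A $ i $ j\<bar> *\<^sub>R
            \<phi> (outer_square (axis i 1 + sgn (A $ i $ j) *\<^sub>R axis j 1))) $ k $ l"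
      by simp
    then have "2 * \<phi> A $ k $ l + (\<Sum>i\<in>UNIV. \<Sum>j\<in>UNIV. \<bar>A $ i $ j\<bar> * (d i k * d i l + d j k * d j l))
       = (\<Sum>i\<in>UNIV. \<Sum>j\<in>UNIV. \<bar>A $ i $ j\<bar> *
            \<phi> (outer_square (axis i 1 + sgn (A $ i $ j) *\<^sub>R axis j 1)) $ k $ l)"
      by (simp add: d_def)
    moreover have "\<bar>A $ i $ j\<bar> * \<phi> (outer_square (axis i 1 + sgn (A $ i $ j) *\<^sub>R axis j 1)) $ k $ l
       = \<bar>A $ i $ j\<bar> * (d i k * d i l + d j k * d j l)
         + (s i j * A $ i $ j * (d i k * d j l) + s i j * A $ i $ j * (d i l * d j k))" for i j
    proof (cases "A $ i $ j = 0")
      case False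
      then have "sgn (A $ i $ j) \<in> {-1, 1}" by (simp add: sgn_if)
      then show ?thesis by (subst s) (simp_all add: sgn_if abs_if algebra_simps)
    qed simp
    ultimately have "2 * \<phi> A $ k $ l = (\<Sum>i\<in>UNIV. \<Sum>j\<in>UNIV. s i j * A $ i $ j * (d i k * d j l))
        + (\<Sum>i\<in>UNIV. \<Sum>j\<in>UNIV. s i j * A $ i $ j * (d i l * d j k))"
      by (simp add: sum.distrib)
    then have "2 * \<phi> A $ k $ l = s k l * A $ k $ l + s l k * A $ l $ k"
      by (simp only: delta)
    then show ?thesis by (simp add: sym algebra_simps)
  qed
  then show ?thesis by (intro exI[of _ "\<lambda>k l. (s k l + s l k) / 2"]) blast
qed

text \<open>
  The all-ones vector exhibits the matrix of multipliers itself as a square \<open>p p\<^sup>t\<close>. The fixed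
  matrices \<open>e\<^sub>k e\<^sub>k\<^sup>t\<close> give \<open>p\<^sub>k\<^sup>2 = 1\<close>, so the diagonal matrix of \<open>p\<close> is its own inverse.
\<close>

lemma (in additive_psd_map) diagonal_congruence:
  assumes outer: "\<And>x. \<exists>y. \<phi> (outer_square x) = outer_square y"
    and basis: "\<And>i. \<phi> (outer_square (axis i 1)) = outer_square (axis i 1)"
  shows "\<exists>D. invertible D \<and> (\<forall>A \<in> psd_matrices. \<phi> A = D ** A ** transpose D)"
proof -
  obtain s where s: "\<And>A k l. A \<in> psd_matrices \<Longrightarrow> \<phi> A $ k $ l = s k l * A $ k $ l"
    using acts_entrywise[OF assms] by blast
  obtain p where p: "\<phi> (outer_square 1) = outer_square p" using outer by blast
  have sp: "s k l = p $ k * p $ l" for k l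
    using s[OF psd_outer_square, of 1 k l] by (simp add: p)
  have pp: "p $ k * p $ k = 1" for k
    using s[OF psd_outer_square, of "axis k 1" k k] unfolding basis sp by (simp add: axis_def)
  define D :: "real ^ 'n ^ 'n" where "D = (\<chi> i j. if i = j then p $ i else 0)"
  have DD: "D ** D = mat 1"
    by (auto simp: D_def matrix_matrix_mult_def vec_eq_iff mat_def if_distrib[of "\<lambda>x. x * _"]
        pp cong: if_cong)
  have "\<phi> A = D ** A ** transpose D" if "A \<in> psd_matrices" for A
    by (auto simp: D_def matrix_matrix_mult_def transpose_def vec_eq_iff s[OF that] sp
        if_distrib[of "\<lambda>x. x * _"] if_distrib[of "\<lambda>x. _ * x"] mult_ac cong: if_cong)
  moreover have "invertible D" using DD by (auto simp: invertible_def)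
  ultimately show ?thesis by blast
qed

section \<open>Congruences and the minus order\<close>

lemma minus_le_congruence:
  fixes S T A B :: "real ^ 'n ^ 'n"
  assumes TS: "T ** S = mat 1" and le: "A \<le>\<^sup>- B"
  shows "S ** A ** transpose S \<le>\<^sup>- S ** B ** transpose S"
proof -
  obtain G where G: "A ** G ** A = A" "G ** A = G ** B" "A ** G = B ** G"
    using le unfolding minus_le_def inner_generalized_inverse_def by blast
  have left: "T ** (S ** X) = X" for X
    by (simp add: TS matrix_mul_assoc)
  have right: "transpose S ** (transpose T ** X) = X" for X
    by (simp add: matrix_mul_assoc flip: matrix_transpose_mul) (simp add: TS transpose_mat)
  let ?G = "transpose T ** G ** T"
  have "(S ** A ** transpose S) ** ?G ** (S ** A ** transpose S) = S ** (A ** G ** A) ** transpose S"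
    by (simp add: left right flip: matrix_mul_assoc)
  moreover have "?G ** (S ** X ** transpose S) = transpose T ** (G ** X) ** transpose S"
    and "(S ** X ** transpose S) ** ?G = S ** (X ** G) ** T" for X
    by (simp_all add: left right flip: matrix_mul_assoc)
  ultimately show ?thesis
    unfolding minus_le_def inner_generalized_inverse_def using G by metis
qed

lemma minus_le_congruence_iff:
  fixes S T A B :: "real ^ 'n ^ 'n"
  assumes ST: "S ** T = mat 1" "T ** S = mat 1"
  shows "S ** A ** transpose S \<le>\<^sup>- S ** B ** transpose S \<longleftrightarrow> A \<le>\<^sup>- B"
  using minus_le_congruence[OF ST(1), of "S ** A ** transpose S" "S ** B ** transpose S"]
    minus_le_congruence[OF ST(2)] congruence_cancel[OF ST(2)] by metis

section \<open>The characterisation\<close>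

theorem theorem3:
  fixes \<phi> :: "real ^ 'n ^ 'n \<Rightarrow> real ^ 'n ^ 'n"
  assumes "CARD('n) \<ge> 3"
    and "\<phi> \<in> psd_matrices \<rightarrow> psd_matrices"
  shows "(\<phi> ` psd_matrices = psd_matrices \<and> additive_on_psd \<phi> \<and>
            preserves_minus_le_both_directions \<phi>) \<longleftrightarrow>
         (\<exists>S :: real ^ 'n ^ 'n. invertible S \<and>
            (\<forall>A \<in> psd_matrices. \<phi> A = S ** A ** transpose S))"
proof (intro iffI; (elim conjE exE)?)
  assume surj: "\<phi> ` psd_matrices = psd_matrices" and additive: "additive_on_psd \<phi>"
    and pres: "preserves_minus_le_both_directions \<phi>"
  interpret additive_psd_map \<phi>
    using assms(2) additive by unfold_locales (auto simp: additive_on_psd_def)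
  obtain f where f: "\<And>x. \<phi> (outer_square x) = outer_square (f x)"
    using outer_square_image[OF surj pres] by metis
  define T :: "real ^ 'n ^ 'n" where "T = (\<chi> k i. f (axis i 1) $ k)"
  have T: "T *v axis i 1 = f (axis i 1)" for i
    by (simp add: T_def matrix_vector_mult_basis column_def vec_eq_iff)
  have "invertible T"
    by (rule images_of_basis_invertible[OF surj]) (simp add: f T)
  then obtain R where R: "T ** R = mat 1" "R ** T = mat 1"
    by (auto simp: invertible_def)
  define \<psi> where "\<psi> A = R ** \<phi> A ** transpose R" for A
  interpret normalised: additive_psd_map \<psi>
    by unfold_locales (simp_all add: \<psi>_def psd_congruence maps add congruence_add)
  have outer: "\<psi> (outer_square x) = outer_square (R *v f x)" for x
    by (simp add: \<psi>_def f outer_square_congruence)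
  have "R *v f (axis i 1) = axis i 1" for i
    by (simp add: matrix_vector_mul_assoc R flip: T)
  then obtain D where D: "invertible D"
      "\<And>A. A \<in> psd_matrices \<Longrightarrow> \<psi> A = D ** A ** transpose D"
    using normalised.diagonal_congruence outer by metis
  have "\<phi> A = (T ** D) ** A ** transpose (T ** D)" if "A \<in> psd_matrices" for A
  proof -
    have "\<phi> A = T ** \<psi> A ** transpose T"
      by (simp add: \<psi>_def congruence_cancel[OF R(1)])
    then show ?thesis
      by (simp add: D(2)[OF that] matrix_transpose_mul matrix_mul_assoc)
  qed
  then show "\<exists>S. invertible S \<and> (\<forall>A \<in> psd_matrices. \<phi> A = S ** A ** transpose S)"
    using invertible_mult[OF \<open>invertible T\<close> D(1)] by blast
next
  fix S :: "real ^ 'n ^ 'n"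
  assume "invertible S" and \<phi>: "\<forall>A \<in> psd_matrices. \<phi> A = S ** A ** transpose S"
  then obtain T where T: "S ** T = mat 1" "T ** S = mat 1"
    by (auto simp: invertible_def)
  have "A \<in> \<phi> ` psd_matrices" if A: "A \<in> psd_matrices" for A
  proof
    show "T ** A ** transpose T \<in> psd_matrices" by (rule psd_congruence[OF A])
    then show "A = \<phi> (T ** A ** transpose T)" by (simp add: \<phi> congruence_cancel[OF T(1)])
  qed
  then have "\<phi> ` psd_matrices = psd_matrices" using assms(2) by blast
  moreover have "additive_on_psd \<phi>"
    by (simp add: additive_on_psd_def \<phi> psd_add congruence_add)
  moreover have "preserves_minus_le_both_directions \<phi>"
    by (simp add: preserves_minus_le_both_directions_def \<phi> minus_le_congruence_iff[OF T])
  ultimately show "\<phi> ` psd_matrices = psd_matrices \<and> additive_on_psd \<phi> \<and>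
      preserves_minus_le_both_directions \<phi>" by blast
qed

end
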